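(* Let $A$, $u_k$, $J_k$, $\widehat P_k$, $E_k$ be as in the context. There is a positive number $\delta$ such that if $\|e_k\|<\delta$ then $$\|\widehat P_k\|\le\frac{2}{\lambda_2-\lambda_1}\big(1+\|E_k\|\big),$$ where $\|\widehat P_k\|=\sup_{w\perp u_k,\,w\ne0}\dfrac{w^\top\widehat P_kw}{w^\top w}$.
   Context: $A\in\mathbb{R}^{n\times n}$ is symmetric positive definite (SPD) with eigenvalues $\lambda_1<\lambda_2<\dots<\lambda_n$ and corresponding unit eigenvectors $v_1,\dots,v_n$. Norms of vectors are Euclidean. Newton iteration for the smallest eigenpair: $u_0$ is a unit vector; for $k\ge 0$, $\theta_k=u_k^\top A u_k$, $r_k=Au_k-\theta_k u_k$ (residual vector), $e_k=u_k-v_1$, and $$J_k=(I-u_ku_k^\top)(A-\theta_k I)(I-u_ku_k^\top).$$ The vector $s_k\ne0$ is the solution, orthogonal to $u_k$, of $J_k s_k=-r_k$, and $u_{k+1}=(u_k+s_k)/\|u_k+s_k\|$. Preconditioners: $\widehat P_0=(LL^\top)^{-1}$ with $L$ a nonsingular lower triangular (incomplete Cholesky) factor, and $$\widehat P_{k+1}=-\frac{s_ks_k^\top}{s_k^\top r_k}+\Big(I-\frac{s_kr_k^\top}{s_k^\top r_k}\Big)\widehat P_k\Big(I-\frac{r_ks_k^\top}{s_k^\top r_k}\Big).$$ The matrices $\widehat P_k$ are taken to be SPD (which holds for iterates close enough to $v_1$). For $u_k$ sufficiently close to $v_1$, $J_k$ is positive semidefinite (positive definite on $u_k^\perp$), $J_k^{1/2}$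 denotes its positive semidefinite square root, and $$E_k=I-J_k^{1/2}\widehat P_kJ_k^{1/2},\qquad \|E_k\|=\sup\{|z^\top E_kz|: z\perp u_k,\ \|z\|=1\}$$ (norms are understood for the restriction to the subspace orthogonal to $u_k$). The number $\delta$ does not depend on $k$. *)

theory Defs
  imports "HOL-Analysis.Analysis"
begin

definition spd :: "real^'n^'n \<Rightarrow> bool" where
  "spd M \<longleftrightarrow> transpose M = M \<and> (\<forall>x. x \<noteq> 0 \<longrightarrow> 0 < x \<bullet> (M *v x))"

definition psd :: "real^'n^'n \<Rightarrow> bool" where
  "psd M \<longleftrightarrow> transpose M = M \<and> (\<forall>x. 0 \<le> x \<bullet> (M *v x))"

text \<open>Unspecified unless \<^term>\<open>M\<close> is positive semidefinite.\<close>
definition psd_sqrt :: "real^'n^'n \<Rightarrow> real^'n^'n" where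
  "psd_sqrt M = (THE R. psd R \<and> R ** R = M)"

definition outer :: "real^'n \<Rightarrow> real^'n \<Rightarrow> real^'n^'n" where
  "outer x y = (\<chi> i j. x $ i * y $ j)"

definition lower_triangular :: "real^('n::{finite,linorder})^('n::{finite,linorder}) \<Rightarrow> bool" where
  "lower_triangular L \<longleftrightarrow> (\<forall>i j. i < j \<longrightarrow> L $ i $ j = 0)"

definition theta :: "real^'n^'n \<Rightarrow> real^'n \<Rightarrow> real" where
  "theta A u = u \<bullet> (A *v u)"

definition residual :: "real^'n^'n \<Rightarrow> real^'n \<Rightarrow> real^'n" where
  "residual A u = A *v u - theta A u *\<^sub>R u"

definition newton_J :: "real^'n^'n \<Rightarrow> real^'n \<Rightarrow> real^'n^'n" where
  "newton_J A u =
     (mat 1 - outer u u) ** (A - theta A u *\<^sub>R mat 1) ** (mat 1 - outer u u)"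

definition newton_iteration ::
  "real^'n^'n \<Rightarrow> (nat \<Rightarrow> real^'n) \<Rightarrow> (nat \<Rightarrow> real^'n) \<Rightarrow> bool" where
  "newton_iteration A u s \<longleftrightarrow>
     norm (u 0) = 1 \<and>
     (\<forall>k. s k \<noteq> 0 \<and> s k \<bullet> u k = 0 \<and>
          newton_J A (u k) *v s k = - residual A (u k) \<and>
          u (Suc k) = (1 / norm (u k + s k)) *\<^sub>R (u k + s k))"

primrec Phat ::
  "real^'n^'n \<Rightarrow> real^'n^'n \<Rightarrow> (nat \<Rightarrow> real^'n) \<Rightarrow> (nat \<Rightarrow> real^'n) \<Rightarrow> nat \<Rightarrow> real^'n^'n" where
  "Phat A L u s 0 = matrix_inv (L ** transpose L)"
| "Phat A L u s (Suc k) =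
     (let r = residual A (u k); c = 1 / (s k \<bullet> r)
      in - (c *\<^sub>R outer (s k) (s k)) +
         (mat 1 - c *\<^sub>R outer (s k) r) ** Phat A L u s k ** (mat 1 - c *\<^sub>R outer r (s k)))"

definition E_mat :: "real^'n^'n \<Rightarrow> real^'n \<Rightarrow> real^'n^'n \<Rightarrow> real^'n^'n" where
  "E_mat A u P = mat 1 - psd_sqrt (newton_J A u) ** P ** psd_sqrt (newton_J A u)"

text \<open>The two norms are those of the restriction to the orthogonal complement of \<^term>\<open>u\<close>;
  both suprema are over nonempty bounded sets when the dimension is at least two and
  \<^term>\<open>u \<noteq> 0\<close>.\<close>
definition E_norm :: "real^'n \<Rightarrow> real^'n^'n \<Rightarrow> real" where
  "E_norm u E = (SUP z\<in>{z. z \<bullet> u = 0 \<and> norm z = 1}. \<bar>z \<bullet> (E *v z)\<bar>)"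

definition P_norm :: "real^'n \<Rightarrow> real^'n^'n \<Rightarrow> real" where
  "P_norm u P = (SUP w\<in>{w. w \<bullet> u = 0 \<and> w \<noteq> 0}. (w \<bullet> (P *v w)) / (w \<bullet> w))"

end

theory Submission
  imports Defs
begin

text \<open>On \<open>u\<^sup>\<bottom>\<close> the Rayleigh quotient of \<open>J\<close> is at least
  \<open>(\<lambda>\<^sub>2 - \<lambda>\<^sub>1) / 2\<close> once \<open>\<parallel>e\<parallel>\<close> is small: a vector \<open>w \<bottom> u\<close> has
  \<open>v\<^sub>1\<close>-component at most \<open>\<parallel>e\<parallel> \<parallel>w\<parallel>\<close>, and \<open>\<theta> - \<lambda>\<^sub>1 = e \<bullet> (A - \<lambda>\<^sub>1 I) e\<close> is quadratic
  in \<open>e\<close>. Hence the square root \<open>R\<close> of \<open>J\<close> is a bijection of \<open>u\<^sup>\<bottom>\<close>, and writing \<open>w = R z\<close> gives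
  \<open>w \<bullet> P w = \<parallel>z\<parallel>\<^sup>2 - z \<bullet> E z \<le> (1 + \<parallel>E\<parallel>) \<parallel>z\<parallel>\<^sup>2\<close> while
  \<open>\<parallel>w\<parallel>\<^sup>2 = z \<bullet> J z \<ge> (\<lambda>\<^sub>2 - \<lambda>\<^sub>1) / 2 \<parallel>z\<parallel>\<^sup>2\<close>.\<close>

lemma symmetric_matrix_inner:
  fixes M :: "real^'n^'n"
  assumes "transpose M = M"
  shows "(M *v x) \<bullet> y = x \<bullet> (M *v y)"
  by (metis assms dot_lmul_matrix transpose_matrix_vector)

lemma quadratic_form_null_vector:
  fixes M :: "real^'n^'n"
  assumes sym: "transpose M = M" and S: "subspace S"
    and nonneg: "\<And>z. z \<in> S \<Longrightarrow> 0 \<le> z \<bullet> (M *v z)"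
    and x: "x \<in> S" "x \<bullet> (M *v x) = 0" and y: "y \<in> S"
  shows "y \<bullet> (M *v x) = 0"
proof (rule ccontr)
  define b q where "b = y \<bullet> (M *v x)" and "q = y \<bullet> (M *v y)"
  assume "y \<bullet> (M *v x) \<noteq> 0"
  then have b: "b \<noteq> 0" by (simp add: b_def)
  have q0: "0 \<le> q" using nonneg[OF y] by (simp add: q_def)
  have expand: "0 \<le> 2 * t * b + t\<^sup>2 * q" for t
  proof -
    have "x \<bullet> (M *v y) = b"
      using symmetric_matrix_inner[OF sym, of x y] by (simp add: b_def inner_commute)
    then have "(x + t *\<^sub>R y) \<bullet> (M *v (x + t *\<^sub>R y)) = 2 * t * b + t\<^sup>2 * q"
      using x(2) by (simp add: matrix_vector_right_distrib matrix_vector_mult_scaleR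
          inner_add_left inner_add_right b_def q_def power2_eq_square algebra_simps)
    moreover have "x + t *\<^sub>R y \<in> S"
      using S x(1) y by (simp add: subspace_add subspace_scale)
    ultimately show ?thesis using nonneg by metis
  qed
  define c where "c = b / (q + 1)"
  have "b = c * (q + 1)" "c \<noteq> 0" using b q0 by (auto simp: c_def)
  then have "2 * (- c) * b + (- c)\<^sup>2 * q = - (c\<^sup>2 * (q + 2))"
    by (simp add: algebra_simps power2_eq_square)
  also have "\<dots> < 0" using \<open>c \<noteq> 0\<close> q0 by simp
  finally show False using expand[of "- c"] by simp
qed

lemma symmetric_eigenvector_in_subspace:
  fixes M :: "real^'n^'n"
  assumes sym: "transpose M = M" and S: "subspace S"
    and inv: "\<And>x. x \<in> S \<Longrightarrow> M *v x \<in> S" and ne: "S \<noteq> {0}"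
  obtains x c where "x \<in> S" "norm x = 1" "M *v x = c *\<^sub>R x"
proof -
  define U where "U = S \<inter> sphere 0 1"
  obtain a where a: "a \<in> S" "a \<noteq> 0"
    using ne subspace_0[OF S] by auto
  then have "a /\<^sub>R norm a \<in> U"
    using S by (simp add: U_def subspace_scale)
  moreover have "compact U"
    unfolding U_def by (intro closed_Int_compact closed_subspace S) auto
  moreover have "continuous_on U (\<lambda>x. x \<bullet> (M *v x))"
    by (intro continuous_intros matrix_vector_mult_linear_continuous_on)
  ultimately obtain x where x: "x \<in> U" and xmax: "\<And>y. y \<in> U \<Longrightarrow> y \<bullet> (M *v y) \<le> x \<bullet> (M *v x)"
    using continuous_attains_sup[of U "\<lambda>x. x \<bullet> (M *v x)"] by blast
  define c where "c = x \<bullet> (M *v x)"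
  define N where "N = c *\<^sub>R mat 1 - M"
  have xS: "x \<in> S" and nx: "norm x = 1" using x by (auto simp: U_def)
  have Nv: "N *v z = c *\<^sub>R z - M *v z" for z
    by (simp add: N_def matrix_vector_mult_diff_rdistrib flip: scaleR_matrix_vector_assoc)
  have Nsym: "transpose N = N"
  proof -
    have "M $ i $ j = M $ j $ i" for i j
      using sym by (metis transpose_def vec_lambda_beta)
    then show ?thesis
      by (simp add: N_def transpose_def mat_def vec_eq_iff)
  qed
  have nonneg: "0 \<le> z \<bullet> (N *v z)" if "z \<in> S" for z
  proof (cases "z = 0")
    case False
    have "z /\<^sub>R norm z \<in> U"
      using that False S by (simp add: U_def subspace_scale)
    then have "(z /\<^sub>R norm z) \<bullet> (M *v (z /\<^sub>R norm z)) \<le> c"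
      unfolding c_def by (rule xmax)
    then have "(z \<bullet> (M *v z)) / (norm z)\<^sup>2 \<le> c"
      by (simp add: matrix_vector_mult_scaleR inverse_eq_divide power2_eq_square)
    then have "z \<bullet> (M *v z) \<le> c * (norm z)\<^sup>2"
      using False by (simp add: pos_divide_le_eq)
    then show ?thesis
      by (simp add: Nv inner_diff_right power2_norm_eq_inner)
  qed auto
  have "x \<bullet> (N *v x) = 0"
    using nx by (simp add: Nv inner_diff_right c_def flip: power2_norm_eq_inner)
  moreover have "N *v x \<in> S"
    unfolding Nv using S xS inv by (simp add: subspace_diff subspace_scale)
  ultimately have "(N *v x) \<bullet> (N *v x) = 0"
    using quadratic_form_null_vector[OF Nsym S nonneg xS] by blast
  then have "M *v x = c *\<^sub>R x" by (simp add: Nv)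
  then show ?thesis using that xS nx by blast
qed

definition orthonormal_eigenbasis :: "real^'n^'n \<Rightarrow> (real^'n) set \<Rightarrow> bool" where
  "orthonormal_eigenbasis M B \<longleftrightarrow> finite B \<and> pairwise orthogonal B \<and> span B = UNIV \<and>
     (\<forall>b\<in>B. norm b = 1 \<and> M *v b = (b \<bullet> (M *v b)) *\<^sub>R b)"

lemma symmetric_eigenbasis_of_subspace:
  fixes M :: "real^'n^'n"
  assumes sym: "transpose M = M"
  shows "subspace S \<Longrightarrow> (\<And>x. x \<in> S \<Longrightarrow> M *v x \<in> S) \<Longrightarrow>
    \<exists>B. finite B \<and> pairwise orthogonal B \<and> span B = S \<and>
      (\<forall>b\<in>B. norm b = 1 \<and> M *v b = (b \<bullet> (M *v b)) *\<^sub>R b)"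
proof (induction "dim S" arbitrary: S rule: less_induct)
  case less
  show ?case
  proof (cases "S = {0}")
    case True
    then show ?thesis by (intro exI[of _ "{}"]) auto
  next
    case False
    then obtain x c where x: "x \<in> S" "norm x = 1" "M *v x = c *\<^sub>R x"
      using symmetric_eigenvector_in_subspace[OF sym less.prems] by blast
    have xx: "x \<bullet> x = 1" using x(2) by (simp flip: power2_norm_eq_inner)
    define S' where "S' = S \<inter> {y. x \<bullet> y = 0}"
    have S': "subspace S'"
      unfolding S'_def by (intro subspace_inter less.prems(1) subspace_hyperplane)
    have inv': "M *v y \<in> S'" if "y \<in> S'" for y
      using that less.prems(2) symmetric_matrix_inner[OF sym, of x y] x(3) by (auto simp: S'_def)
    have "S' \<subset> S" using x(1) xx unfolding S'_def by force
    then have "dim S' < dim S"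
      using less.prems(1) S' by (metis dim_psubset span_eq_iff)
    then obtain B where B: "finite B" "pairwise orthogonal B" "span B = S'"
        and eig: "\<And>b. b \<in> B \<Longrightarrow> norm b = 1 \<and> M *v b = (b \<bullet> (M *v b)) *\<^sub>R b"
      using less.hyps[OF _ S' inv'] by blast
    have BS: "b \<in> S'" if "b \<in> B" for b using that B(3) span_base by blast
    have "pairwise orthogonal (insert x B)"
      using B(2) BS by (auto simp: pairwise_insert orthogonal_def S'_def inner_commute)
    moreover have "span (insert x B) = S"
    proof
      show "span (insert x B) \<subseteq> S"
        using BS x(1) less.prems(1) by (intro span_minimal) (auto simp: S'_def)
      show "S \<subseteq> span (insert x B)"
      proof
        fix y assume "y \<in> S"
        then have "y - (x \<bullet> y) *\<^sub>R x \<in> S'"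
          using x(1) xx less.prems(1)
          by (simp add: S'_def inner_diff_right subspace_diff subspace_scale)
        then show "y \<in> span (insert x B)"
          unfolding span_insert B(3) by blast
      qed
    qed
    ultimately show ?thesis
      using B(1) eig x(2,3) xx by (intro exI[of _ "insert x B"]) auto
  qed
qed

lemma symmetric_eigenbasis_exists:
  fixes M :: "real^'n^'n"
  assumes "transpose M = M"
  obtains B where "orthonormal_eigenbasis M B"
  using symmetric_eigenbasis_of_subspace[OF assms, of UNIV] that
  unfolding orthonormal_eigenbasis_def by auto

lemma outer_mult_vec: "outer x y *v z = (y \<bullet> z) *\<^sub>R x"
  by (simp add: outer_def matrix_vector_mult_def vec_eq_iff inner_vec_def sum_distrib_right
      sum_distrib_left mult_ac)

lemma sum_matrix_mult_vec: "(\<Sum>b\<in>B. F b) *v x = (\<Sum>b\<in>B. F b *v x)"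
  for F :: "'b \<Rightarrow> real^'n^'m"
  by (induction B rule: infinite_finite_induct) (auto simp: matrix_vector_mult_add_rdistrib)

lemma psd_sqrt_exists:
  fixes M :: "real^'n^'n"
  assumes "psd M"
  shows "\<exists>R. psd R \<and> R ** R = M"
proof -
  obtain B where "orthonormal_eigenbasis M B"
    using assms symmetric_eigenbasis_exists unfolding psd_def by blast
  then have B: "finite B" "pairwise orthogonal B" "span B = UNIV"
    and nB: "\<And>b. b \<in> B \<Longrightarrow> norm b = 1"
    and eig: "\<And>b. b \<in> B \<Longrightarrow> M *v b = (b \<bullet> (M *v b)) *\<^sub>R b"
    by (auto simp: orthonormal_eigenbasis_def)
  define r where "r b = sqrt (b \<bullet> (M *v b))" for b
  define R where "R = (\<Sum>b\<in>B. r b *\<^sub>R outer b b)"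
  have r0: "0 \<le> r b" and r2: "r b * r b = b \<bullet> (M *v b)" for b
    using assms by (auto simp: r_def psd_def)
  have Rv: "R *v x = (\<Sum>b\<in>B. (r b * (b \<bullet> x)) *\<^sub>R b)" for x
    by (simp add: R_def sum_matrix_mult_vec outer_mult_vec flip: scaleR_matrix_vector_assoc)
  have RB: "R *v b = r b *\<^sub>R b" if "b \<in> B" for b
  proof -
    have "(r a * (a \<bullet> b)) *\<^sub>R a = (if a = b then r b *\<^sub>R b else 0)" if "a \<in> B" for a
      using B(2) nB[OF \<open>b \<in> B\<close>] that \<open>b \<in> B\<close>
      by (auto simp: pairwise_def orthogonal_def norm_eq_1)
    then have "R *v b = (\<Sum>a\<in>B. if a = b then r b *\<^sub>R b else 0)"
      unfolding Rv by (intro sum.cong) auto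
    then show ?thesis using B(1) that by simp
  qed
  have "R ** R = M"
    unfolding matrix_eq
  proof
    fix x
    show "(R ** R) *v x = M *v x"
    proof (rule linear_eq_on_span[where B = B and f = "(*v) (R ** R)" and g = "(*v) M"])
      fix b assume b: "b \<in> B"
      have "(R ** R) *v b = (r b * r b) *\<^sub>R b"
        using RB[OF b] by (simp add: matrix_vector_mult_scaleR flip: matrix_vector_mul_assoc)
      also have "\<dots> = M *v b"
        using eig[OF b] by (simp add: r2)
      finally show "(R ** R) *v b = M *v b" .
    qed (use B in auto)
  qed
  moreover have "transpose R = R"
    by (simp add: R_def transpose_def outer_def vec_eq_iff mult_ac)
  moreover have "0 \<le> x \<bullet> (R *v x)" for x
    unfolding Rv inner_sum_right
    by (intro sum_nonneg) (auto simp: inner_commute r0 mult.assoc)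
  ultimately show ?thesis by (auto simp: psd_def)
qed

text \<open>On an eigenvector of \<open>R\<close> with eigenvalue \<open>r\<close>, the equation \<open>(S + r) (S - r) b = 0\<close> and the
  positivity of \<open>S\<close> force \<open>S b = r b\<close>; so \<open>R\<close> and \<open>S\<close> agree on an eigenbasis of \<open>R\<close>.\<close>

lemma psd_sqrt_unique:
  fixes R S :: "real^'n^'n"
  assumes R: "psd R" and S: "psd S" and eq: "R ** R = S ** S"
  shows "R = S"
proof -
  obtain B where "orthonormal_eigenbasis R B"
    using R symmetric_eigenbasis_exists unfolding psd_def by blast
  then have B: "span B = UNIV" and eig: "\<And>b. b \<in> B \<Longrightarrow> R *v b = (b \<bullet> (R *v b)) *\<^sub>R b"
    by (auto simp: orthonormal_eigenbasis_def)
  have agree: "R *v b = S *v b" if "b \<in> B" for b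
  proof -
    define r where "r = b \<bullet> (R *v b)"
    define y where "y = S *v b - r *\<^sub>R b"
    have Rb: "R *v b = r *\<^sub>R b" using eig[OF that] by (simp add: r_def)
    have r0: "0 \<le> r" using R by (simp add: r_def psd_def)
    have "S *v (S *v b) = R *v (R *v b)"
      using eq by (simp add: matrix_vector_mul_assoc)
    also have "\<dots> = (r * r) *\<^sub>R b" by (simp add: Rb matrix_vector_mult_scaleR)
    finally have SS: "S *v (S *v b) = (r * r) *\<^sub>R b" .
    have "S *v b = r *\<^sub>R b"
    proof (cases "r = 0")
      case True
      have "(S *v b) \<bullet> (S *v b) = b \<bullet> (S *v (S *v b))"
        using S symmetric_matrix_inner unfolding psd_def by blast
      then show ?thesis using SS True by simp
    next
      case False
      have "S *v y = - (r *\<^sub>R y)"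
        by (simp add: y_def matrix_vector_mult_diff_distrib matrix_vector_mult_scaleR SS
            scaleR_diff_right)
      then have "y \<bullet> (S *v y) = - (r * (y \<bullet> y))" by simp
      moreover have "0 \<le> y \<bullet> (S *v y)" using S by (simp add: psd_def)
      ultimately have "r * (y \<bullet> y) \<le> 0" by simp
      then have "y \<bullet> y \<le> 0" using False r0 by (simp add: mult_le_0_iff)
      then have "y = 0" by (metis inner_gt_zero_iff not_le)
      then show ?thesis by (simp add: y_def)
    qed
    then show ?thesis using Rb by simp
  qed
  show ?thesis
    unfolding matrix_eq
  proof
    fix x show "R *v x = S *v x"
      by (rule linear_eq_on_span[where B = B and f = "(*v) R" and g = "(*v) S"]) (use B agree in auto)
  qed
qed

lemma psd_sqrt:
  assumes "psd M"
  shows "psd (psd_sqrt M)" and "psd_sqrt M ** psd_sqrt M = M"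
proof -
  have "\<exists>!R. psd R \<and> R ** R = M"
    using psd_sqrt_exists[OF assms] psd_sqrt_unique by metis
  from theI'[OF this] show "psd (psd_sqrt M)" "psd_sqrt M ** psd_sqrt M = M"
    unfolding psd_sqrt_def by auto
qed

lemma quadratic_form_eigenbasis:
  assumes "orthonormal_eigenbasis M B"
  shows "w \<bullet> (M *v w) = (\<Sum>b\<in>B. (b \<bullet> (M *v b)) * (w \<bullet> b)\<^sup>2)"
    and "w \<bullet> w = (\<Sum>b\<in>B. (w \<bullet> b)\<^sup>2)"
proof -
  have B: "finite B" "pairwise orthogonal B" "span B = UNIV"
    and nB: "\<And>b. b \<in> B \<Longrightarrow> norm b = 1"
    and eig: "\<And>b. b \<in> B \<Longrightarrow> M *v b = (b \<bullet> (M *v b)) *\<^sub>R b"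
    using assms by (auto simp: orthonormal_eigenbasis_def)
  have w: "(\<Sum>b\<in>B. (w \<bullet> b) *\<^sub>R b) = w"
    using B nB by (intro orthonormal_basis_expand) auto
  have "w \<bullet> (M *v w) = w \<bullet> (M *v (\<Sum>b\<in>B. (w \<bullet> b) *\<^sub>R b))" by (simp add: w)
  also have "\<dots> = (\<Sum>b\<in>B. (w \<bullet> b) * (w \<bullet> (M *v b)))"
    by (simp add: linear_sum[OF matrix_vector_mul_linear] matrix_vector_mult_scaleR inner_sum_right)
  also have "\<dots> = (\<Sum>b\<in>B. (b \<bullet> (M *v b)) * (w \<bullet> b)\<^sup>2)"
  proof (rule sum.cong)
    fix b assume "b \<in> B"
    then have "w \<bullet> (M *v b) = (b \<bullet> (M *v b)) * (w \<bullet> b)" by (metis eig inner_scaleR_right)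
    then show "(w \<bullet> b) * (w \<bullet> (M *v b)) = (b \<bullet> (M *v b)) * (w \<bullet> b)\<^sup>2"
      by (simp add: power2_eq_square)
  qed simp
  finally show "w \<bullet> (M *v w) = (\<Sum>b\<in>B. (b \<bullet> (M *v b)) * (w \<bullet> b)\<^sup>2)" .
  have "w \<bullet> w = w \<bullet> (\<Sum>b\<in>B. (w \<bullet> b) *\<^sub>R b)" by (simp add: w)
  then show "w \<bullet> w = (\<Sum>b\<in>B. (w \<bullet> b)\<^sup>2)" by (simp add: inner_sum_right power2_eq_square)
qed

lemma simple_spectrum_eigenbasis:
  fixes A :: "real^'n^'n" and v :: "nat \<Rightarrow> real^'n"
  assumes sym: "transpose A = A" and inj: "inj_on lam {1..CARD('n)}"
    and v: "\<And>i. i \<in> {1..CARD('n)} \<Longrightarrow> norm (v i) = 1 \<and> A *v v i = lam i *\<^sub>R v i"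
  shows "orthonormal_eigenbasis A (v ` {1..CARD('n)})" and "inj_on v {1..CARD('n)}"
proof -
  let ?I = "{1..CARD('n)}"
  have v1: "v i \<bullet> v i = 1" if "i \<in> ?I" for i
    using v[OF that] by (simp flip: power2_norm_eq_inner)
  have orth: "v i \<bullet> v j = 0" if "i \<in> ?I" "j \<in> ?I" "i \<noteq> j" for i j
  proof -
    have "lam i * (v i \<bullet> v j) = lam j * (v i \<bullet> v j)"
      using symmetric_matrix_inner[OF sym, of "v i" "v j"] v that by simp
    moreover have "lam i \<noteq> lam j" using inj that by (auto dest: inj_onD)
    ultimately show ?thesis by simp
  qed
  show injv: "inj_on v ?I"
    by (rule inj_onI) (metis orth v1 zero_neq_one)
  have pw: "pairwise orthogonal (v ` ?I)"
    unfolding pairwise_def orthogonal_def by (auto intro!: orth)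
  then have "independent (v ` ?I)"
    by (rule pairwise_orthogonal_independent) (use v in force)
  then have "span (v ` ?I) = UNIV"
    using card_ge_dim_independent[of "v ` ?I" UNIV] card_image[OF injv] by auto
  then show "orthonormal_eigenbasis A (v ` ?I)"
    unfolding orthonormal_eigenbasis_def using pw v v1 by auto
qed

lemma simple_spectrum_lower_bound:
  fixes A :: "real^'n^'n" and v :: "nat \<Rightarrow> real^'n"
  assumes n: "CARD('n) \<ge> 2" and sym: "transpose A = A"
    and mono: "strict_mono_on {1..CARD('n)} lam"
    and v: "\<And>i. i \<in> {1..CARD('n)} \<Longrightarrow> norm (v i) = 1 \<and> A *v v i = lam i *\<^sub>R v i"
  shows "lam 2 * (w \<bullet> w) - (lam 2 - lam 1) * (w \<bullet> v 1)\<^sup>2 \<le> w \<bullet> (A *v w)"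
proof -
  let ?I = "{1..CARD('n)}"
  have basis: "orthonormal_eigenbasis A (v ` ?I)" "inj_on v ?I"
    using simple_spectrum_eigenbasis[OF sym strict_mono_on_imp_inj_on[OF mono]] v by blast+
  have lam: "v i \<bullet> (A *v v i) = lam i" if "i \<in> ?I" for i
    using v[OF that] by (simp flip: power2_norm_eq_inner)
  have one: "1 \<in> ?I" using n by simp
  have "w \<bullet> (A *v w) - lam 2 * (w \<bullet> w) = (\<Sum>i\<in>?I. (lam i - lam 2) * (w \<bullet> v i)\<^sup>2)"
    unfolding quadratic_form_eigenbasis(1)[OF basis(1), of w]
      quadratic_form_eigenbasis(2)[OF basis(1), of w] sum.reindex[OF basis(2)] sum_distrib_left sum_subtractf[symmetric]
    by (rule sum.cong) (simp_all add: lam left_diff_distrib)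
  also have "\<dots> = (lam 1 - lam 2) * (w \<bullet> v 1)\<^sup>2
      + (\<Sum>i\<in>?I - {1}. (lam i - lam 2) * (w \<bullet> v i)\<^sup>2)"
    using one by (intro sum.remove) simp_all
  finally have eq: "w \<bullet> (A *v w) - lam 2 * (w \<bullet> w) = \<dots>" .
  have "lam 2 \<le> lam i" if "i \<in> ?I - {1}" for i
    using that n strict_mono_on_leD[OF mono, of 2 i] by auto
  then have "0 \<le> (\<Sum>i\<in>?I - {1}. (lam i - lam 2) * (w \<bullet> v i)\<^sup>2)"
    by (intro sum_nonneg) auto
  with eq show ?thesis by (simp add: algebra_simps)
qed

lemma newton_J_mult_vec:
  "newton_J A u *v x =
    (let y = x - (u \<bullet> x) *\<^sub>R u; z = A *v y - theta A u *\<^sub>R y in z - (u \<bullet> z) *\<^sub>R u)"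
  by (simp add: newton_J_def Let_def matrix_vector_mult_diff_rdistrib outer_mult_vec
      flip: matrix_vector_mul_assoc scaleR_matrix_vector_assoc)

lemma transpose_diff: "transpose (X - Y) = transpose X - transpose Y"
  for X Y :: "real^'n^'m"
  by (simp add: transpose_def vec_eq_iff)

lemma newton_J_symmetric:
  fixes A :: "real^'n^'n"
  assumes "transpose A = A"
  shows "transpose (newton_J A u) = newton_J A u"
proof -
  have "transpose (outer u u) = outer u u"
    by (simp add: transpose_def outer_def vec_eq_iff mult.commute)
  moreover have "transpose (c *\<^sub>R mat 1) = c *\<^sub>R (mat 1 :: real^'n^'n)" for c
    by (simp add: transpose_def mat_def vec_eq_iff)
  ultimately show ?thesis
    unfolding newton_J_def
    by (simp only: matrix_transpose_mul transpose_diff transpose_mat assms matrix_mul_assoc)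
qed

lemma newton_J_form:
  assumes "norm u = 1"
  defines "y \<equiv> \<lambda>x. x - (u \<bullet> x) *\<^sub>R u"
  shows "x \<bullet> (newton_J A u *v x) = y x \<bullet> (A *v y x) - theta A u * (y x \<bullet> y x)"
    and "u \<bullet> y x = 0"
proof -
  have uu: "u \<bullet> u = 1" using assms by (simp flip: power2_norm_eq_inner)
  then show uy: "u \<bullet> y x = 0" by (simp add: y_def inner_diff_right)
  define z where "z = A *v y x - theta A u *\<^sub>R y x"
  have "x \<bullet> (newton_J A u *v x) = x \<bullet> z - (u \<bullet> z) * (x \<bullet> u)"
    by (simp add: newton_J_mult_vec Let_def z_def y_def inner_diff_right)
  also have "\<dots> = y x \<bullet> z" by (simp add: y_def inner_diff_left inner_commute[of x u])
  finally show "x \<bullet> (newton_J A u *v x) = y x \<bullet> (A *v y x) - theta A u * (y x \<bullet> y x)"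
    by (simp add: z_def inner_diff_right)
qed

lemma theta_minus_eigenvalue_bound:
  fixes A :: "real^'n^'n"
  assumes sym: "transpose A = A" and eig: "A *v v = c *\<^sub>R v"
  obtains K where "0 < K" "\<And>u. norm u = 1 \<Longrightarrow> theta A u - c \<le> K * (norm (u - v))\<^sup>2"
proof -
  define f where "f = (\<lambda>x. A *v x - c *\<^sub>R x)"
  have "bounded_linear f"
    unfolding f_def by (intro bounded_linear_sub bounded_linear_scaleR_right) simp
  then obtain K where K: "0 < K" "\<And>x. norm (f x) \<le> norm x * K"
    using bounded_linear.pos_bounded by blast
  have "theta A u - c \<le> K * (norm (u - v))\<^sup>2" if "norm u = 1" for u
  proof -
    have "f u = f (u - v)"
      using eig by (simp add: f_def matrix_vector_mult_diff_distrib algebra_simps)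
    moreover have "f u \<bullet> v = 0"
      using symmetric_matrix_inner[OF sym, of u v] eig by (simp add: f_def inner_diff_left)
    moreover have "theta A u - c = f u \<bullet> u"
      using that
      by (simp add: theta_def f_def inner_diff_left inner_commute[of u] flip: power2_norm_eq_inner)
    ultimately have "theta A u - c = f (u - v) \<bullet> (u - v)"
      by (simp add: inner_diff_right)
    also have "\<dots> \<le> norm (f (u - v)) * norm (u - v)" by (rule norm_cauchy_schwarz)
    also have "\<dots> \<le> norm (u - v) * K * norm (u - v)" using K(2) by (intro mult_right_mono) auto
    finally show ?thesis by (simp add: power2_eq_square mult_ac)
  qed
  with K(1) show ?thesis using that by blast
qed

lemma preconditioner_norm_bound:
  fixes J P :: "real^'n^'n"
  assumes n: "CARD('n) \<ge> 2" and u: "u \<noteq> 0" and J: "psd J" and Ju: "J *v u = 0"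
    and g: "0 < g" and coercive: "\<And>z. z \<bullet> u = 0 \<Longrightarrow> g * (z \<bullet> z) \<le> z \<bullet> (J *v z)"
  defines "E \<equiv> mat 1 - psd_sqrt J ** P ** psd_sqrt J"
  shows "P_norm u P \<le> (1 + E_norm u E) / g"
proof -
  define R where "R = psd_sqrt J"
  have Rsym: "transpose R = R" and RR: "R ** R = J"
    using psd_sqrt[OF J] by (auto simp: R_def psd_def)
  have RJ: "(R *v x) \<bullet> (R *v y) = x \<bullet> (J *v y)" for x y
    using symmetric_matrix_inner[OF Rsym] by (simp add: matrix_vector_mul_assoc flip: RR)
  have "R *v u = 0" using RJ[of u u] Ju by simp
  then have Ru: "(R *v x) \<bullet> u = 0" for x
    using symmetric_matrix_inner[OF Rsym, of x u] by simp
  have R0: "z = 0" if "z \<bullet> u = 0" "R *v z = 0" for z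
  proof -
    have "g * (z \<bullet> z) \<le> 0" using coercive[OF that(1)] RJ[of z z] that(2) by simp
    then have "z \<bullet> z \<le> 0" using g by (simp add: mult_le_0_iff)
    then show ?thesis by (metis inner_gt_zero_iff not_le)
  qed
  have range: "\<exists>z. z \<bullet> u = 0 \<and> R *v z = w" if "w \<bullet> u = 0" for w
  proof -
    define T where "T = (\<lambda>x. R *v x + (x \<bullet> u) *\<^sub>R u)"
    have linT: "linear T"
      unfolding T_def
      by (rule linearI) (simp_all add: matrix_vector_right_distrib matrix_vector_mult_scaleR
          inner_add_left algebra_simps)
    have Tu: "T x \<bullet> u = (x \<bullet> u) * (u \<bullet> u)" for x by (simp add: T_def inner_add_left Ru)
    have "x = 0" if "T x = 0" for x
    proof -
      have "x \<bullet> u = 0" using Tu[of x] that u by simp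
      then show ?thesis using R0[of x] that by (simp add: T_def)
    qed
    then have "surj T"
      using linT by (simp add: linear_injective_0 linear_injective_imp_surjective)
    then obtain z where z: "w = T z" by blast
    then have "z \<bullet> u = 0" using Tu[of z] that u by simp
    then show ?thesis using z by (auto simp: T_def)
  qed
  have Eform: "z \<bullet> (E *v z) = z \<bullet> z - (R *v z) \<bullet> (P *v (R *v z))" for z
    using symmetric_matrix_inner[OF Rsym]
    by (simp add: E_def R_def[symmetric] matrix_vector_mult_diff_rdistrib inner_diff_right
        flip: matrix_vector_mul_assoc)
  obtain K where K: "\<And>x. norm (E *v x) \<le> norm x * K"
    using bounded_linear.pos_bounded[OF matrix_vector_mul_bounded_linear[of E]] by blast
  have bdd: "bdd_above ((\<lambda>z. \<bar>z \<bullet> (E *v z)\<bar>) ` {z. z \<bullet> u = 0 \<and> norm z = 1})"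
  proof (rule bdd_aboveI2)
    fix z assume "z \<in> {z. z \<bullet> u = 0 \<and> norm z = 1}"
    then show "\<bar>z \<bullet> (E *v z)\<bar> \<le> K"
      using Cauchy_Schwarz_ineq2[of z "E *v z"] K[of z] by simp
  qed
  have Ebound: "- (z \<bullet> (E *v z)) \<le> E_norm u E * (z \<bullet> z)" if "z \<bullet> u = 0" "z \<noteq> 0" for z
  proof -
    have "\<bar>(z /\<^sub>R norm z) \<bullet> (E *v (z /\<^sub>R norm z))\<bar> \<le> E_norm u E"
      unfolding E_norm_def by (rule cSUP_upper[OF _ bdd]) (use that in simp)
    moreover have "(z /\<^sub>R norm z) \<bullet> (E *v (z /\<^sub>R norm z)) = (z \<bullet> (E *v z)) / (z \<bullet> z)"
      by (simp add: matrix_vector_mult_scaleR dot_square_norm power2_eq_square field_simps)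
    ultimately have "\<bar>(z \<bullet> (E *v z)) / (z \<bullet> z)\<bar> \<le> E_norm u E" by simp
    moreover have "0 < z \<bullet> z" using that by simp
    ultimately show ?thesis by (simp add: abs_le_iff field_simps)
  qed
  obtain w0 where w0: "w0 \<noteq> 0" "orthogonal u w0"
    using n orthogonal_to_vector_exists[of u] by (auto simp: orthogonal_def)
  show ?thesis
    unfolding P_norm_def
  proof (rule cSUP_least)
    show "{w. w \<bullet> u = 0 \<and> w \<noteq> 0} \<noteq> {}"
      using w0 by (auto simp: orthogonal_def inner_commute)
  next
    fix w assume "w \<in> {w. w \<bullet> u = 0 \<and> w \<noteq> 0}"
    then have w: "w \<bullet> u = 0" "w \<noteq> 0" by auto
    obtain z where z: "z \<bullet> u = 0" "R *v z = w" using range[OF w(1)] by blast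
    have "z \<noteq> 0" using z(2) w(2) by auto
    then have zz: "0 < z \<bullet> z" by simp
    have num: "w \<bullet> (P *v w) \<le> (1 + E_norm u E) * (z \<bullet> z)"
      using Eform[of z] Ebound[OF z(1) \<open>z \<noteq> 0\<close>] z(2) by (simp add: algebra_simps)
    have den: "g * (z \<bullet> z) \<le> w \<bullet> w"
      using coercive[OF z(1)] RJ[of z z] z(2) by simp
    have "0 \<le> E_norm u E"
    proof -
      have "0 \<le> \<bar>(z /\<^sub>R norm z) \<bullet> (E *v (z /\<^sub>R norm z))\<bar>" by simp
      also have "\<dots> \<le> E_norm u E"
        unfolding E_norm_def by (rule cSUP_upper[OF _ bdd]) (use z(1) \<open>z \<noteq> 0\<close> in simp)
      finally show ?thesis .
    qed
    then have "(w \<bullet> (P *v w)) / (w \<bullet> w) \<le> ((1 + E_norm u E) * (z \<bullet> z)) / (g * (z \<bullet> z))"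
      using num den zz g by (intro frac_le) auto
    then show "(w \<bullet> (P *v w)) / (w \<bullet> w) \<le> (1 + E_norm u E) / g"
      using zz by simp
  qed
qed

lemma newton_iteration_norm:
  assumes "newton_iteration A u s"
  shows "norm (u k) = 1"
proof (induction k)
  case 0
  then show ?case using assms by (simp add: newton_iteration_def)
next
  case (Suc k)
  have "s k \<bullet> u k = 0" using assms by (simp add: newton_iteration_def)
  then have "(u k + s k) \<bullet> u k = 1"
    using Suc by (simp add: inner_add_left flip: power2_norm_eq_inner)
  then have "u k + s k \<noteq> 0" by auto
  moreover have "u (Suc k) = (1 / norm (u k + s k)) *\<^sub>R (u k + s k)"
    using assms by (simp add: newton_iteration_def)
  ultimately show ?case by simp
qed

theorem lemma3p3:
  fixes A :: "real^('n::{finite,linorder})^('n::{finite,linorder})"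
    and lam :: "nat \<Rightarrow> real"
    and v :: "nat \<Rightarrow> real^('n::{finite,linorder})"
  assumes "CARD('n) \<ge> 2"
    and "spd A"
    and "strict_mono_on {1..CARD('n)} lam"
    and "\<And>i. i \<in> {1..CARD('n)} \<Longrightarrow> norm (v i) = 1 \<and> A *v v i = lam i *\<^sub>R v i"
  shows "\<exists>\<delta>>0. \<forall>(L :: real^('n::{finite,linorder})^('n::{finite,linorder})) u s.
           lower_triangular L \<and> invertible L \<and> newton_iteration A u s \<and>
           (\<forall>j. spd (Phat A L u s j)) \<longrightarrow>
           (\<forall>k. norm (u k - v 1) < \<delta> \<longrightarrow>
              P_norm (u k) (Phat A L u s k)
                \<le> 2 / (lam 2 - lam 1) * (1 + E_norm (u k) (E_mat A (u k) (Phat A L u s k))))"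
proof -
  let ?g = "lam 2 - lam 1"
  have sym: "transpose A = A" using assms(2) by (simp add: spd_def)
  have g: "0 < ?g" using strict_mono_onD[OF assms(3), of 1 2] assms(1) by simp
  have v1: "norm (v 1) = 1" "A *v v 1 = lam 1 *\<^sub>R v 1" using assms(1,4) by auto
  obtain K where K: "0 < K" "\<And>u. norm u = 1 \<Longrightarrow> theta A u - lam 1 \<le> K * (norm (u - v 1))\<^sup>2"
    using theta_minus_eigenvalue_bound[OF sym v1(2)] by blast
  define \<delta> where "\<delta> = sqrt (?g / (2 * (?g + K)))"
  have \<delta>: "0 < \<delta>" "(?g + K) * \<delta>\<^sup>2 = ?g / 2"
    using g K(1) by (auto simp: \<delta>_def field_simps)
  have coercive: "?g / 2 * (w \<bullet> w) \<le> w \<bullet> (A *v w) - theta A u * (w \<bullet> w)"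
    if u: "norm u = 1" "norm (u - v 1) < \<delta>" and w: "u \<bullet> w = 0" for u w
  proof -
    let ?e = "(norm (u - v 1))\<^sup>2"
    have "w \<bullet> v 1 = - (w \<bullet> (u - v 1))" using w by (simp add: inner_diff_right inner_commute)
    then have "(w \<bullet> v 1)\<^sup>2 \<le> (w \<bullet> w) * ?e"
      using Cauchy_Schwarz_ineq[of w "u - v 1"] by (simp add: power2_norm_eq_inner)
    then have "?g * (w \<bullet> v 1)\<^sup>2 \<le> ?g * ((w \<bullet> w) * ?e)"
      using g by (intro mult_left_mono) auto
    moreover have "theta A u * (w \<bullet> w) \<le> lam 1 * (w \<bullet> w) + K * ((w \<bullet> w) * ?e)"
      using mult_right_mono[OF K(2)[OF u(1)], of "w \<bullet> w"] by (simp add: algebra_simps)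
    moreover have "?g * ((w \<bullet> w) * ?e) + K * ((w \<bullet> w) * ?e) \<le> ?g / 2 * (w \<bullet> w)"
    proof -
      have "?e \<le> \<delta>\<^sup>2" using u(2) by (intro power_mono) auto
      then have "(?g + K) * ?e \<le> (?g + K) * \<delta>\<^sup>2" using g K(1) by (intro mult_left_mono) auto
      then have "(?g + K) * ?e * (w \<bullet> w) \<le> ?g / 2 * (w \<bullet> w)"
        unfolding \<delta>(2) by (intro mult_right_mono) auto
      then show ?thesis by (simp only: distrib_right mult.assoc mult.commute[of ?e])
    qed
    moreover have "?g / 2 * (w \<bullet> w) + ?g / 2 * (w \<bullet> w) = lam 2 * (w \<bullet> w) - lam 1 * (w \<bullet> w)"
      by (simp add: field_simps)
    moreover note simple_spectrum_lower_bound[OF assms(1) sym assms(3,4), of w]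
    ultimately show ?thesis by linarith
  qed
  have bound: "P_norm u P \<le> 2 / ?g * (1 + E_norm u (E_mat A u P))"
    if u: "norm u = 1" "norm (u - v 1) < \<delta>" for u P
  proof -
    have uu: "u \<bullet> u = 1" using u(1) by (simp flip: power2_norm_eq_inner)
    have "psd (newton_J A u)"
      unfolding psd_def
    proof (intro conjI allI)
      fix x
      let ?y = "x - (u \<bullet> x) *\<^sub>R u"
      have "0 \<le> ?g / 2 * (?y \<bullet> ?y)" using g by simp
      also have "\<dots> \<le> x \<bullet> (newton_J A u *v x)"
        unfolding newton_J_form[OF u(1)] by (intro coercive u newton_J_form(2))
      finally show "0 \<le> x \<bullet> (newton_J A u *v x)" .
    qed (rule newton_J_symmetric[OF sym])
    moreover have "newton_J A u *v u = 0"
      by (simp add: newton_J_mult_vec Let_def uu)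
    moreover have "?g / 2 * (z \<bullet> z) \<le> z \<bullet> (newton_J A u *v z)" if "z \<bullet> u = 0" for z
      using coercive[OF u, of z] newton_J_form(1)[OF u(1), of z A] that by (simp add: inner_commute)
    moreover have "u \<noteq> 0" using u(1) by auto
    ultimately have "P_norm u P \<le> (1 + E_norm u (E_mat A u P)) / (?g / 2)"
      unfolding E_mat_def using g by (intro preconditioner_norm_bound assms(1)) auto
    then show ?thesis by (simp add: algebra_simps)
  qed
  show ?thesis
    using \<delta>(1) bound newton_iteration_norm by blast
qed

end
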